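(* Let $\varepsilon_0>0$ and let $\Theta_\varepsilon:[0,\pi]\to[0,\pi]$, $\varepsilon\in(0,\varepsilon_0)$, be a family of increasing homeomorphisms. Assume there are constants $C,\beta,\beta',\delta>0$ (independent of $\varepsilon$) and a real number $\alpha>2\beta'/\beta-1$ such that: (1) $\Theta_\varepsilon(0)=0$ and $\Theta_\varepsilon(\pi)=\pi$; (2) for all $\theta\in[0,\pi]$, $\Theta_\varepsilon(\pi-\theta)=\pi-\Theta_\varepsilon(\theta)$; (3) for all $\theta_1,\theta_2\in[0,\pi]$ with $\theta_1+\theta_2\in[0,\pi]$, $\Theta_\varepsilon(\theta_1)+\Theta_\varepsilon(\theta_2)\le\Theta_\varepsilon(\theta_1+\theta_2)$; (4) for every family of continuous convex functions $J_\varepsilon:[0,\pi]\to\mathbb R$ with $\|J_\varepsilon\|_{L^\infty}=\mathcal O(\varepsilon^{-\alpha})$ as $\varepsilon\to0$, $$\int_0^\pi J_\varepsilon(\Theta_\varepsilon(\theta))\sin\theta\,d\theta\le\int_0^\pi J_\varepsilon(\theta)\sin\theta\,d\theta+\mathcal O(\varepsilon);$$ (5) for all $\theta_1,\theta_2\in[0,\pi]$, $|\Theta_\varepsilon(\theta_1)-\Theta_\varepsilon(\theta_2)|\le C\big(\varepsilon^{\delta}+\varepsilon^{-\beta'}|\theta_1-\theta_2|^{\beta}\big)$. Then $\sup_{\theta\in[0,\pi]}|\Theta_\varepsilon(\theta)-\theta|=\mathcal O(\varepsilon^\gamma)$ as $\varepsilon\to0$, for every $\gamma>0$ such that $\gamma\le\hat\gamma$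 and $\gamma<\delta$, where $$\hat\gamma:=\frac{1+\alpha-2\beta'/\beta}{1+2/\beta}.$$
   Context: $\mathcal O(\cdot)$ is meant as $\varepsilon\to0$, with a constant that may depend on the family considered but not on $\varepsilon$. *)

theory Defs
  imports "HOL-Analysis.Analysis" "HOL-Library.Landau_Symbols"
begin

end

theory Submission
  imports Defs "HOL-Real_Asymp.Real_Asymp"
begin

text \<open>
  Write \<open>f = \<Theta>\<^sub>\<epsilon> - id\<close> for the displacement. Two opposite tendencies meet.
  Superadditivity with the symmetry about \<open>\<pi>/2\<close> makes \<open>\<Theta>\<^sub>\<epsilon>\<close> push mass outwards, towards
  \<open>0\<close> and \<open>\<pi>\<close>; the inequality for convex functions says that \<open>\<Theta>\<^sub>\<epsilon>\<close> can do so only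
  up to a small error. A single family of test functions makes the conflict quantitative.

  Since \<open>f (\<pi>/2) = 0\<close>, superadditivity gives \<open>f b + f (\<pi>/2 - b) \<le> 0\<close>. Together with the
  antisymmetry of \<open>f\<close> this moves any displacement into one that is directed
  towards \<open>0\<close> in the left half: the maximum \<open>m\<close> of \<open>|f|\<close> equals \<open>a - \<Theta>\<^sub>\<epsilon> a\<close> for some
  \<open>a \<in> (0, \<pi>/2]\<close> (\<open>maximal_displacement_attained_leftwards\<close>). In particular \<open>m \<le> a\<close>, because
  \<open>\<Theta>\<^sub>\<epsilon> \<ge> 0\<close>.

  Test now with the convex function \<open>cosine_cap a\<close>, which is \<open>1 - cos (a - x)\<close> left of \<open>a\<close> and
  vanishes right of \<open>a\<close>. Bounding it below by its tangents, its integral grows under \<open>\<Theta>\<^sub>\<epsilon>\<close> by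
  at least \<open>- \<integral>\<^sub>0\<^sup>a sin (a - x) sin x f(x) dx\<close>. The weight is symmetric under \<open>x \<mapsto> a - x\<close>, so that
  superadditivity, in the form \<open>f x + f (a - x) \<le> f a = - m\<close>, bounds this from below by
  \<open>m/2\<close> times the integral of the weight, a multiple of \<open>m a\<^sup>3\<close>
  (\<open>cosine_cap_detects_displacement\<close>). The cap is at most \<open>a\<^sup>2\<close>, so it may be scaled by
  \<open>\<epsilon>\<^sup>-\<^sup>\<alpha> / a\<^sup>2\<close>, and the hypothesis on convex functions yields \<open>m\<^sup>2 \<le> m a = O(\<epsilon>\<^sup>1\<^sup>+\<^sup>\<alpha>)\<close>.

  This proves the rate \<open>(1 + \<alpha>)/2\<close>. It covers the claimed range of \<open>\<gamma>\<close> because a Hoelder estimate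
  that is too good at scale \<open>\<epsilon>\<^sup>\<gamma>\<close> would contradict \<open>\<Theta>\<^sub>\<epsilon> \<pi> - \<Theta>\<^sub>\<epsilon> 0 = \<pi>\<close>: one has
  \<open>\<gamma> (\<beta> - 1) \<le> \<beta>'\<close> (\<open>hoelder_exponent_constraint\<close>), which with the assumed upper bound on \<open>\<gamma>\<close>
  gives \<open>2 \<gamma> \<le> 1 + \<alpha>\<close>.
\<close>

section \<open>The convex test function\<close>

text \<open>
  The supporting slopes may be chosen freely, so this also applies to functions glued from two
  formulas, without any derivative at the seam.
\<close>
lemma convex_on_if_supporting_slopes:
  fixes f g :: "real \<Rightarrow> real"
  assumes "convex S"
    and slope: "\<And>x y. x \<in> S \<Longrightarrow> y \<in> S \<Longrightarrow> f x + g x * (y - x) \<le> f y"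
  shows "convex_on S f"
proof (rule convex_onI)
  fix t x y :: real
  assume t: "0 < t" "t < 1" and xy: "x \<in> S" "y \<in> S"
  define z where "z = (1 - t) * x + t * y"
  have z: "z \<in> S"
    using convexD[OF assms(1) xy, of "1 - t" t] t by (simp add: z_def)
  have "(1 - t) * (f z + g z * (x - z)) + t * (f z + g z * (y - z)) \<le> (1 - t) * f x + t * f y"
    using t slope[OF z xy(1)] slope[OF z xy(2)] by (intro add_mono mult_left_mono) auto
  moreover have "(1 - t) * (f z + g z * (x - z)) + t * (f z + g z * (y - z)) = f z"
    by (simp add: z_def algebra_simps)
  ultimately show "f ((1 - t) *\<^sub>R x + t *\<^sub>R y) \<le> (1 - t) * f x + t * f y"
    by (simp add: z_def)
qed (fact assms(1))

lemma sin_ge_chord: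
  fixes x :: real
  assumes "0 \<le> x" "x \<le> pi / 2"
  shows "2 / pi * x \<le> sin x"
proof -
  have "convex_on {0..pi/2} (\<lambda>x. - sin x)"
    by (rule f''_ge0_imp_convex[where f' = "\<lambda>x. - cos x" and f'' = sin])
      (auto intro!: derivative_eq_intros sin_ge_zero)
  then have "- sin ((1 - 2 / pi * x) *\<^sub>R 0 + (2 / pi * x) *\<^sub>R (pi / 2))
      \<le> (1 - 2 / pi * x) * (- sin 0) + (2 / pi * x) * (- sin (pi / 2))"
    using assms by (intro convex_onD) (auto simp: field_simps)
  then show ?thesis by simp
qed

lemma cos_le_tangent:
  fixes u v :: real
  assumes "u \<in> {0..pi/2}" "v \<in> {0..pi/2}"
  shows "cos v \<le> cos u - sin u * (v - u)"
proof -
  have conv: "convex_on {0..pi/2} (\<lambda>x. - cos x)"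
    by (rule f''_ge0_imp_convex[where f' = sin and f'' = cos])
      (auto intro!: derivative_eq_intros cos_ge_zero)
  have mono: "sin s \<le> sin t" if "0 \<le> s" "s \<le> t" "t \<le> pi/2" for s t :: real
    using that by (intro sin_monotone_2pi_le) auto
  consider "u < v" | "u = v" | "v < u" by linarith
  then show ?thesis
  proof cases
    case 1
    obtain z where z: "u < z" "z < v" "cos v - cos u = (v - u) * - sin z"
      using MVT2[OF 1, of cos "\<lambda>x. - sin x"] by auto
    have "sin u * (v - u) \<le> sin z * (v - u)"
      using z assms 1 by (intro mult_right_mono mono) auto
    then show ?thesis using z by (simp add: algebra_simps)
  next
    case 2 then show ?thesis by simp
  next
    case 3
    obtain z where z: "v < z" "z < u" "cos u - cos v = (u - v) * - sin z"
      using MVT2[OF 3, of cos "\<lambda>x. - sin x"] by auto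
    have "sin z * (u - v) \<le> sin u * (u - v)"
      using z assms 3 by (intro mult_right_mono mono) auto
    then show ?thesis using z by (simp add: algebra_simps)
  qed
qed

text \<open>
  The slope at \<open>x \<le> a\<close> is \<open>- sin (a - x)\<close>. It is increasing for \<open>a \<le> pi / 2\<close>, and its product with
  the density \<open>sin x\<close> is symmetric about \<open>a / 2\<close>. This symmetry is the reason for a cosine instead of
  a parabola: superadditivity controls \<open>f x\<close> and \<open>f (a - x)\<close> only through their sum.
\<close>
definition cosine_cap :: "real \<Rightarrow> real \<Rightarrow> real"
  where "cosine_cap a x = 1 - cos (max (a - x) 0)"

lemma continuous_on_cosine_cap: "continuous_on S (cosine_cap a)"
  unfolding cosine_cap_def by (intro continuous_intros)

text \<open>
  The distance \<open>max (a - x) 0\<close> to the left of \<open>a\<close> is itself convex in \<open>x\<close>, and \<open>1 - cos\<close> is convex and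
  increasing on \<open>[0, pi/2]\<close>; composing the two tangent inequalities gives the claim.
\<close>
lemma cosine_cap_above_tangent:
  assumes "a \<le> pi / 2" "0 \<le> x" "0 \<le> y"
  shows "cosine_cap a x - sin (max (a - x) 0) * (y - x) \<le> cosine_cap a y"
proof -
  define u v where "u = max (a - x) 0" and "v = max (a - y) 0"
  have uv: "u \<in> {0..pi/2}" "v \<in> {0..pi/2}"
    using assms pi_gt_zero by (simp_all add: u_def v_def max_def)
  \<comment> \<open>the tangent inequality for \<open>x \<mapsto> max (a - x) 0\<close>; at \<open>u = 0\<close> the factor \<open>sin u\<close> hides the kink\<close>
  have "0 \<le> sin u * (v - u + (y - x))"
  proof (cases "x \<le> a")
    case True
    then have "0 \<le> v - u + (y - x)" by (auto simp: u_def v_def)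
    then show ?thesis using uv by (intro mult_nonneg_nonneg sin_ge_zero) auto
  next
    case False
    then show ?thesis by (simp add: u_def)
  qed
  then show ?thesis
    using cos_le_tangent[OF uv]
    by (simp add: cosine_cap_def algebra_simps flip: u_def v_def)
qed

lemma convex_on_cosine_cap:
  assumes "a \<le> pi / 2"
  shows "convex_on {0..b} (cosine_cap a)"
  using cosine_cap_above_tangent[OF assms]
  by (intro convex_on_if_supporting_slopes[where g = "\<lambda>x. - sin (max (a - x) 0)"]) auto

lemma cosine_cap_bounds:
  assumes "0 \<le> a" "0 \<le> x"
  shows "0 \<le> cosine_cap a x" "cosine_cap a x \<le> a\<^sup>2"
proof -
  define u where "u = max (a - x) 0"
  show "0 \<le> cosine_cap a x" by (simp add: cosine_cap_def)
  have "\<bar>sin (u / 2)\<bar> \<le> \<bar>u / 2\<bar>" by (rule abs_sin_x_le_abs_x)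
  then have "(sin (u / 2))\<^sup>2 \<le> (u / 2)\<^sup>2" by (simp only: abs_le_square_iff)
  then have "(sin (u / 2))\<^sup>2 \<le> u\<^sup>2 / 4" by (simp add: power_divide)
  moreover have "cos u = 1 - 2 * (sin (u / 2))\<^sup>2"
    using cos_double_sin[of "u / 2"] by simp
  moreover have "u\<^sup>2 \<le> a\<^sup>2" using assms by (intro power_mono) (auto simp: u_def)
  ultimately show "cosine_cap a x \<le> a\<^sup>2"
    using zero_le_power2[of u] unfolding cosine_cap_def u_def[symmetric] by linarith
qed

section \<open>Displacement seen by the test function\<close>

text \<open>
  Reflecting the integral at \<open>a / 2\<close> and averaging replaces \<open>f x\<close> by \<open>(f x + f (a - x)) / 2\<close>.
\<close>
lemma integral_symmetric_weight_le:
  fixes f w :: "real \<Rightarrow> real"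
  assumes "0 \<le> a" and f: "continuous_on {0..a} f" and w: "continuous_on {0..a} w"
    and sym: "\<And>x. x \<in> {0..a} \<Longrightarrow> w (a - x) = w x"
    and nonneg: "\<And>x. x \<in> {0..a} \<Longrightarrow> 0 \<le> w x"
    and pair: "\<And>x. x \<in> {0..a} \<Longrightarrow> f x + f (a - x) \<le> c"
  shows "2 * integral {0..a} (\<lambda>x. w x * f x) \<le> c * integral {0..a} w"
proof -
  define I where "I = integral {0..a} (\<lambda>x. w x * f x)"
  have "((\<lambda>x. w x * f x) has_integral I) {0..a}"
    unfolding I_def by (intro integrable_integral integrable_continuous_real continuous_intros f w)
  moreover from has_integral_affinity[of "\<lambda>x. w x * f x" I 0 a "-1" a] this
  have "((\<lambda>x. w (a - x) * f (a - x)) has_integral I) {0..a}"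
    using assms(1) by (simp add: image_affinity_atLeastAtMost)
  ultimately have "((\<lambda>x. w x * f x + w (a - x) * f (a - x)) has_integral I + I) {0..a}"
    by (rule has_integral_add)
  moreover have "((\<lambda>x. c * w x) has_integral c * integral {0..a} w) {0..a}"
    by (intro has_integral_mult_right integrable_integral integrable_continuous_real w)
  moreover have "w x * f x + w (a - x) * f (a - x) \<le> c * w x" if "x \<in> {0..a}" for x
    using mult_left_mono[OF pair[OF that] nonneg[OF that]] sym[OF that]
    by (simp add: algebra_simps)
  ultimately have "I + I \<le> c * integral {0..a} w" by (rule has_integral_le)
  then show ?thesis by (simp add: I_def)
qed

lemma integral_sin_reflected_sin_ge:
  assumes "0 \<le> a" "a \<le> pi / 2"
  shows "2 * a ^ 3 / (3 * pi\<^sup>2) \<le> integral {0..a} (\<lambda>x. sin (a - x) * sin x)"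
proof -
  have "((\<lambda>x. (a - x) * x) has_integral (a * a\<^sup>2 / 2 - a ^ 3 / 3) - (a * 0\<^sup>2 / 2 - 0 ^ 3 / 3)) {0..a}"
    using assms(1)
    by (intro fundamental_theorem_of_calculus)
      (auto intro!: derivative_eq_intros
        simp: has_real_derivative_iff_has_vector_derivative[symmetric] power2_eq_square algebra_simps)
  then have "((\<lambda>x. 4 / pi\<^sup>2 * ((a - x) * x)) has_integral 4 / pi\<^sup>2 * (a ^ 3 / 6)) {0..a}"
    by (intro has_integral_mult_right) (simp add: power3_eq_cube power2_eq_square mult.assoc)
  then have "((\<lambda>x. 4 / pi\<^sup>2 * ((a - x) * x)) has_integral 2 * a ^ 3 / (3 * pi\<^sup>2)) {0..a}"
    by (simp add: field_simps)
  moreover have "((\<lambda>x. sin (a - x) * sin x) has_integral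
      integral {0..a} (\<lambda>x. sin (a - x) * sin x)) {0..a}"
    by (intro integrable_integral integrable_continuous_real continuous_intros)
  moreover have "4 / pi\<^sup>2 * ((a - x) * x) \<le> sin (a - x) * sin x" if "x \<in> {0..a}" for x
  proof -
    have "(2 / pi * (a - x)) * (2 / pi * x) \<le> sin (a - x) * sin x"
      using that assms by (intro mult_mono sin_ge_chord sin_ge_zero) auto
    moreover have "(2 / pi * (a - x)) * (2 / pi * x) = 4 / pi\<^sup>2 * ((a - x) * x)"
      by (simp add: field_simps power2_eq_square)
    ultimately show ?thesis by simp
  qed
  ultimately show ?thesis by (rule has_integral_le)
qed

text \<open>
  The first-order term of the cap, \<open>- k\<close> in the proof, lives on \<open>[0, a]\<close>, where its
  weight \<open>sin (a - x) sin x\<close> is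
  symmetric, and the displacements of \<open>x\<close> and \<open>a - x\<close> add up to at most \<open>T a - a\<close>. Hence
  displacing \<open>a\<close> to the left forces mass towards \<open>0\<close> and raises the integral of the cap.
\<close>
lemma cosine_cap_detects_displacement:
  fixes T :: "real \<Rightarrow> real"
  assumes a: "0 \<le> a" "a \<le> pi / 2"
    and cont: "continuous_on {0..pi} T"
    and range: "\<And>x. x \<in> {0..pi} \<Longrightarrow> 0 \<le> T x"
    and super: "\<And>x y. 0 \<le> x \<Longrightarrow> 0 \<le> y \<Longrightarrow> x + y = a \<Longrightarrow> T x + T y \<le> T a"
    and neg: "T a \<le> a"
  shows "(a - T a) * a ^ 3 / (3 * pi\<^sup>2) + integral {0..pi} (\<lambda>x. cosine_cap a x * sin x)
    \<le> integral {0..pi} (\<lambda>x. cosine_cap a (T x) * sin x)"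
proof -
  define k where "k = (\<lambda>x. sin (max (a - x) 0) * sin x * (T x - x))"
  have a_pi: "a \<le> pi" using a pi_gt_zero by linarith
  have conta: "continuous_on {0..a} T"
    using cont by (rule continuous_on_subset) (use a_pi in auto)
  have contk: "continuous_on {0..pi} k"
    unfolding k_def by (intro continuous_intros cont)
  have "integral {a..pi} k = 0"
  proof (rule integral_unique, rule has_integral_is_0)
    show "k x = 0" if "x \<in> {a..pi}" for x using that by (simp add: k_def)
  qed
  then have "integral {0..pi} k = integral {0..a} k"
    using Henstock_Kurzweil_Integration.integral_combine[OF a(1) a_pi integrable_continuous_real[OF contk]] by simp
  also have "integral {0..a} k = integral {0..a} (\<lambda>x. (sin (a - x) * sin x) * (T x - x))"
    by (intro integral_cong) (auto simp: k_def)
  finally have restrict: "integral {0..pi} k = \<dots>" .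
  have "2 * integral {0..a} (\<lambda>x. (sin (a - x) * sin x) * (T x - x))
      \<le> (T a - a) * integral {0..a} (\<lambda>x. sin (a - x) * sin x)"
  proof (rule integral_symmetric_weight_le)
    show "T x - x + (T (a - x) - (a - x)) \<le> T a - a" if "x \<in> {0..a}" for x
      using super[of x "a - x"] that by auto
    show "0 \<le> sin (a - x) * sin x" if "x \<in> {0..a}" for x
      using that a_pi by (intro mult_nonneg_nonneg sin_ge_zero) auto
  qed (auto intro!: continuous_intros conta simp: a)
  also have "\<dots> \<le> (T a - a) * (2 * a ^ 3 / (3 * pi\<^sup>2))"
    using neg by (intro mult_left_mono_neg integral_sin_reflected_sin_ge a) auto
  finally have upper: "integral {0..pi} k \<le> - ((a - T a) * a ^ 3 / (3 * pi\<^sup>2))"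
    unfolding restrict by (simp add: field_simps)
  have "integral {0..pi} (\<lambda>x. cosine_cap a x * sin x - k x)
      \<le> integral {0..pi} (\<lambda>x. cosine_cap a (T x) * sin x)"
  proof (rule integral_le)
    show "(\<lambda>x. cosine_cap a x * sin x - k x) integrable_on {0..pi}"
      by (intro integrable_continuous_real continuous_intros contk continuous_on_cosine_cap)
    show "(\<lambda>x. cosine_cap a (T x) * sin x) integrable_on {0..pi}"
      unfolding cosine_cap_def by (intro integrable_continuous_real continuous_intros cont)
    show "cosine_cap a x * sin x - k x \<le> cosine_cap a (T x) * sin x" if "x \<in> {0..pi}" for x
    proof -
      have "(cosine_cap a x - sin (max (a - x) 0) * (T x - x)) * sin x \<le> cosine_cap a (T x) * sin x"
        using that range[OF that] a
        by (intro mult_right_mono cosine_cap_above_tangent sin_ge_zero) auto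
      then show ?thesis by (simp add: k_def algebra_simps)
    qed
  qed
  also have "integral {0..pi} (\<lambda>x. cosine_cap a x * sin x - k x)
      = integral {0..pi} (\<lambda>x. cosine_cap a x * sin x) - integral {0..pi} k"
    by (intro integral_diff integrable_continuous_real continuous_intros contk continuous_on_cosine_cap)
  finally show ?thesis using upper by linarith
qed

text \<open>
  A point where \<open>|T x - x|\<close> is maximal can be reflected into \<open>[0, pi/2]\<close> by the symmetry. If it is
  displaced to the right there, then superadditivity below the fixed point \<open>pi / 2\<close> displaces its
  complement \<open>pi / 2 - x\<close> to the left by at least as much.
\<close>
lemma maximal_displacement_attained_leftwards:
  fixes T :: "real \<Rightarrow> real"
  assumes cont: "continuous_on {0..pi} T"
    and sym: "\<And>x. x \<in> {0..pi} \<Longrightarrow> T (pi - x) = pi - T x"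
    and super: "\<And>x y. x \<in> {0..pi} \<Longrightarrow> y \<in> {0..pi} \<Longrightarrow> x + y \<in> {0..pi} \<Longrightarrow> T x + T y \<le> T (x + y)"
    and zero: "T 0 = 0"
  obtains a where "0 < a" "a \<le> pi / 2" "\<And>x. x \<in> {0..pi} \<Longrightarrow> \<bar>T x - x\<bar> \<le> a - T a"
proof -
  have mid: "T (pi / 2) = pi / 2" using sym[of "pi / 2"] by simp
  have "continuous_on {0..pi} (\<lambda>x. \<bar>T x - x\<bar>)" by (intro continuous_intros cont)
  then obtain s where s: "s \<in> {0..pi}" and max: "\<And>x. x \<in> {0..pi} \<Longrightarrow> \<bar>T x - x\<bar> \<le> \<bar>T s - s\<bar>"
    using continuous_attains_sup[of "{0..pi}" "\<lambda>x. \<bar>T x - x\<bar>"] by auto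
  have "\<exists>b. 0 \<le> b \<and> b \<le> pi / 2 \<and> \<bar>T b - b\<bar> = \<bar>T s - s\<bar>"
  proof (cases "s \<le> pi / 2")
    case True
    then show ?thesis using s by auto
  next
    case False
    then show ?thesis using s sym[OF s] by (intro exI[of _ "pi - s"]) auto
  qed
  then obtain b where b: "0 \<le> b" "b \<le> pi / 2" "\<bar>T b - b\<bar> = \<bar>T s - s\<bar>" by blast
  have "\<exists>c. 0 \<le> c \<and> c \<le> pi / 2 \<and> \<bar>T s - s\<bar> \<le> c - T c"
  proof (cases "T b \<le> b")
    case True
    then show ?thesis using b by auto
  next
    case False
    have "T b + T (pi / 2 - b) \<le> pi / 2"
      using super[of b "pi / 2 - b"] b mid by auto
    then show ?thesis using b False by (intro exI[of _ "pi / 2 - b"]) auto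
  qed
  then obtain c where c: "0 \<le> c" "c \<le> pi / 2" "\<bar>T s - s\<bar> \<le> c - T c" by blast
  \<comment> \<open>\<open>c = 0\<close> happens only for \<open>T = id\<close>, when any point serves\<close>
  show ?thesis
  proof (cases "c = 0")
    case False
    then show ?thesis using that[of c] c max by force
  next
    case True
    then have "\<bar>T s - s\<bar> = 0" using c zero by simp
    then show ?thesis using that[of "pi / 2"] max mid by force
  qed
qed

section \<open>Admissible exponents\<close>

lemma increment_le_uniform_steps:
  fixes T :: "real \<Rightarrow> real"
  assumes "0 \<le> L" "0 < N"
    and step: "\<And>x y. x \<in> {0..L} \<Longrightarrow> y \<in> {0..L} \<Longrightarrow> y - x = L / real N \<Longrightarrow> T y - T x \<le> d"
  shows "T L - T 0 \<le> real N * d"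
proof -
  define p where "p i = L * real i / real N" for i
  have "T L - T 0 = T (p N) - T (p 0)" using assms by (simp add: p_def)
  also have "\<dots> = (\<Sum>i<N. T (p (Suc i)) - T (p i))"
    by (rule sum_lessThan_telescope[symmetric])
  also have "\<dots> \<le> (\<Sum>i<N. d)"
  proof (rule sum_mono)
    fix i assume "i \<in> {..<N}"
    then have "L * real i \<le> L * real N" "L * (1 + real i) \<le> L * real N"
      using assms(1) by (auto intro!: mult_left_mono)
    then show "T (p (Suc i)) - T (p i) \<le> d"
      using assms(1,2) by (intro step) (auto simp: p_def field_simps)
  qed
  finally show ?thesis by simp
qed

text \<open>
  Cut \<open>[0, pi]\<close> into about \<open>\<epsilon>\<^sup>-\<^sup>\<gamma>\<close> equal steps. Summing the Hoelder bound over them shows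
  \<open>pi = O(\<epsilon>\<^sup>\<delta>\<^sup>-\<^sup>\<gamma> + \<epsilon>\<^sup>s)\<close> with \<open>s = \<gamma> (\<beta> - 1) - \<beta>'\<close>; for \<open>s > 0\<close> the right-hand side
  tends to \<open>0\<close> with \<open>\<epsilon>\<close>.
\<close>
lemma hoelder_exponent_constraint:
  fixes T :: "real \<Rightarrow> real \<Rightarrow> real" and \<epsilon>\<^sub>0 C \<beta> \<beta>' \<gamma> \<delta> :: real
  assumes "0 < \<epsilon>\<^sub>0" "0 < C" "0 < \<beta>'" "0 < \<gamma>" "\<gamma> < \<delta>"
    and ends: "\<And>\<epsilon>. \<epsilon> \<in> {0<..<\<epsilon>\<^sub>0} \<Longrightarrow> T \<epsilon> 0 = 0 \<and> T \<epsilon> pi = pi"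
    and hoelder: "\<And>\<epsilon> x y. \<epsilon> \<in> {0<..<\<epsilon>\<^sub>0} \<Longrightarrow> x \<in> {0..pi} \<Longrightarrow> y \<in> {0..pi} \<Longrightarrow>
      \<bar>T \<epsilon> x - T \<epsilon> y\<bar> \<le> C * (\<epsilon> powr \<delta> + \<epsilon> powr (- \<beta>') * \<bar>x - y\<bar> powr \<beta>)"
  shows "\<gamma> * (\<beta> - 1) \<le> \<beta>'"
proof (rule ccontr)
  assume "\<not> \<gamma> * (\<beta> - 1) \<le> \<beta>'"
  then have gap: "0 < \<gamma> * (\<beta> - 1) - \<beta>'" by simp
  then have "0 < \<gamma> * (\<beta> - 1)" using assms by linarith
  then have "1 < \<beta>" using assms by (simp add: zero_less_mult_iff)
  define E where "E \<epsilon> = 2 * C * (\<epsilon> powr (\<delta> - \<gamma>) + pi powr \<beta> * \<epsilon> powr (\<gamma> * (\<beta> - 1) - \<beta>'))" for \<epsilon>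
  have small: "((\<lambda>\<epsilon>::real. \<epsilon> powr e) \<longlongrightarrow> 0) (at_right 0)" if "0 < e" for e :: real
    using that by real_asymp
  have "(E \<longlongrightarrow> 2 * C * (0 + pi powr \<beta> * 0)) (at_right 0)"
    unfolding E_def by (intro tendsto_intros small) (use gap assms in auto)
  then have "\<forall>\<^sub>F \<epsilon> in at_right 0. E \<epsilon> < pi"
    by (intro order_tendstoD(2)) auto
  moreover have "\<forall>\<^sub>F \<epsilon> in at_right 0. \<epsilon> \<in> {0<..<min \<epsilon>\<^sub>0 1}"
    using assms(1) by (intro eventually_at_right_real) auto
  ultimately have "\<forall>\<^sub>F \<epsilon> in at_right 0. E \<epsilon> < pi \<and> \<epsilon> \<in> {0<..<min \<epsilon>\<^sub>0 1}"
    by (rule eventually_conj)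
  then obtain \<epsilon> where \<epsilon>: "E \<epsilon> < pi" "0 < \<epsilon>" "\<epsilon> < \<epsilon>\<^sub>0" "\<epsilon> < 1"
    using eventually_happens[of _ "at_right (0::real)"] by auto
  define N where "N = nat \<lceil>\<epsilon> powr (- \<gamma>)\<rceil>"
  have ge1: "1 \<le> \<epsilon> powr (- \<gamma>)"
    using \<epsilon> assms by (simp add: powr_minus powr_le1 one_le_inverse_iff)
  then have N: "\<epsilon> powr (- \<gamma>) \<le> real N" "real N \<le> 2 * \<epsilon> powr (- \<gamma>)"
    unfolding N_def by linarith+
  then have N_pos: "0 < N" using ge1 by linarith
  have "pi / real N \<le> pi / \<epsilon> powr (- \<gamma>)"
    using N \<epsilon> ge1 by (intro divide_left_mono) auto
  also have "\<dots> = pi * \<epsilon> powr \<gamma>" by (simp add: powr_minus field_simps)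
  finally have step: "pi / real N \<le> pi * \<epsilon> powr \<gamma>" .
  define d where "d = C * (\<epsilon> powr \<delta> + \<epsilon> powr (- \<beta>') * (pi * \<epsilon> powr \<gamma>) powr \<beta>)"
  have d_nonneg: "0 \<le> d" using assms by (simp add: d_def)
  have "T \<epsilon> pi - T \<epsilon> 0 \<le> real N * d"
  proof (rule increment_le_uniform_steps)
    fix x y assume xy: "x \<in> {0..pi}" "y \<in> {0..pi}" "y - x = pi / real N"
    have "T \<epsilon> y - T \<epsilon> x \<le> C * (\<epsilon> powr \<delta> + \<epsilon> powr (- \<beta>') * \<bar>y - x\<bar> powr \<beta>)"
      using hoelder[of \<epsilon> y x] xy \<epsilon> by force
    also have "\<dots> \<le> d"
      unfolding d_def using xy(3) step \<open>1 < \<beta>\<close> assms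
      by (intro mult_left_mono add_left_mono powr_mono2) auto
    finally show "T \<epsilon> y - T \<epsilon> x \<le> d" .
  qed (auto simp: N_pos)
  also have "\<dots> \<le> 2 * \<epsilon> powr (- \<gamma>) * d"
    using N d_nonneg by (intro mult_right_mono)
  also have "\<dots> = 2 * C * (\<epsilon> powr (- \<gamma>) * \<epsilon> powr \<delta>
      + pi powr \<beta> * (\<epsilon> powr (- \<gamma>) * \<epsilon> powr (- \<beta>') * \<epsilon> powr (\<gamma> * \<beta>)))"
    using \<epsilon> by (simp add: d_def powr_mult powr_powr algebra_simps)
  also have "\<dots> = E \<epsilon>"
    unfolding E_def powr_add[symmetric] by (simp add: algebra_simps)
  finally show False using ends[of \<epsilon>] \<epsilon> by simp
qed

text \<open>
  The assumption \<open>constraint\<close> rearranges to \<open>\<gamma> \<le> (\<gamma> + \<beta>') / \<beta>\<close>, and \<open>rate\<close> becomes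
  \<open>\<gamma> + 2 (\<gamma> + \<beta>') / \<beta> \<le> 1 + \<alpha>\<close> when multiplied by \<open>1 + 2 / \<beta>\<close>. So even \<open>3 \<gamma> \<le> 1 + \<alpha>\<close> holds.
\<close>
lemma rate_exponent_le_half:
  fixes \<alpha> \<beta> \<beta>' \<gamma> :: real
  assumes "0 < \<beta>" "0 < \<beta>'" "0 < \<gamma>" and constraint: "\<gamma> * (\<beta> - 1) \<le> \<beta>'"
    and rate: "\<gamma> \<le> (1 + \<alpha> - 2 * \<beta>' / \<beta>) / (1 + 2 / \<beta>)"
  shows "2 * \<gamma> \<le> 1 + \<alpha>"
proof -
  have "0 < 1 + 2 / \<beta>" using assms by (simp add: add_pos_pos)
  then have "\<gamma> * (1 + 2 / \<beta>) \<le> 1 + \<alpha> - 2 * \<beta>' / \<beta>"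
    using rate by (simp add: pos_le_divide_eq)
  then have "\<gamma> + 2 * ((\<gamma> + \<beta>') / \<beta>) \<le> 1 + \<alpha>"
    by (simp add: algebra_simps add_divide_distrib)
  moreover have "\<gamma> \<le> (\<gamma> + \<beta>') / \<beta>"
    using assms by (simp add: pos_le_divide_eq algebra_simps)
  ultimately show ?thesis using assms by linarith
qed

section \<open>Quantitative rigidity\<close>

theorem proposition5p1:
  fixes \<Theta> :: "real \<Rightarrow> real \<Rightarrow> real" and \<epsilon>\<^sub>0 C \<beta> \<beta>' \<delta> \<alpha> :: real
  assumes "\<epsilon>\<^sub>0 > 0"
    and "C > 0" and "\<beta> > 0" and "\<beta>' > 0" and "\<delta> > 0"
    and "\<alpha> > 2 * \<beta>' / \<beta> - 1"
    and homeo: "\<And>\<epsilon>. \<epsilon> \<in> {0<..<\<epsilon>\<^sub>0} \<Longrightarrow> \<exists>\<Psi>. homeomorphism {0..pi} {0..pi} (\<Theta> \<epsilon>) \<Psi>"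
    and increasing: "\<And>\<epsilon>. \<epsilon> \<in> {0<..<\<epsilon>\<^sub>0} \<Longrightarrow> strict_mono_on {0..pi} (\<Theta> \<epsilon>)"
    and endpoints: "\<And>\<epsilon>. \<epsilon> \<in> {0<..<\<epsilon>\<^sub>0} \<Longrightarrow> \<Theta> \<epsilon> 0 = 0 \<and> \<Theta> \<epsilon> pi = pi"
    and symmetric: "\<And>\<epsilon> \<theta>. \<epsilon> \<in> {0<..<\<epsilon>\<^sub>0} \<Longrightarrow> \<theta> \<in> {0..pi} \<Longrightarrow> \<Theta> \<epsilon> (pi - \<theta>) = pi - \<Theta> \<epsilon> \<theta>"
    and superadditive: "\<And>\<epsilon> \<theta>\<^sub>1 \<theta>\<^sub>2. \<epsilon> \<in> {0<..<\<epsilon>\<^sub>0} \<Longrightarrow> \<theta>\<^sub>1 \<in> {0..pi} \<Longrightarrow> \<theta>\<^sub>2 \<in> {0..pi} \<Longrightarrow>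
      \<theta>\<^sub>1 + \<theta>\<^sub>2 \<in> {0..pi} \<Longrightarrow> \<Theta> \<epsilon> \<theta>\<^sub>1 + \<Theta> \<epsilon> \<theta>\<^sub>2 \<le> \<Theta> \<epsilon> (\<theta>\<^sub>1 + \<theta>\<^sub>2)"
    and convex_ineq: "\<And>J :: real \<Rightarrow> real \<Rightarrow> real.
      (\<And>\<epsilon>. \<epsilon> \<in> {0<..<\<epsilon>\<^sub>0} \<Longrightarrow> continuous_on {0..pi} (J \<epsilon>) \<and> convex_on {0..pi} (J \<epsilon>)) \<Longrightarrow>
      (\<lambda>\<epsilon>. SUP \<theta>\<in>{0..pi}. \<bar>J \<epsilon> \<theta>\<bar>) \<in> O[at_right 0](\<lambda>\<epsilon>. \<epsilon> powr (- \<alpha>)) \<Longrightarrow>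
      \<exists>R :: real \<Rightarrow> real. R \<in> O[at_right 0](\<lambda>\<epsilon>. \<epsilon>) \<and>
        (\<forall>\<epsilon>\<in>{0<..<\<epsilon>\<^sub>0}. integral {0..pi} (\<lambda>\<theta>. J \<epsilon> (\<Theta> \<epsilon> \<theta>) * sin \<theta>)
                    \<le> integral {0..pi} (\<lambda>\<theta>. J \<epsilon> \<theta> * sin \<theta>) + R \<epsilon>)"
    and hoelder: "\<And>\<epsilon> \<theta>\<^sub>1 \<theta>\<^sub>2. \<epsilon> \<in> {0<..<\<epsilon>\<^sub>0} \<Longrightarrow> \<theta>\<^sub>1 \<in> {0..pi} \<Longrightarrow> \<theta>\<^sub>2 \<in> {0..pi} \<Longrightarrow>
      \<bar>\<Theta> \<epsilon> \<theta>\<^sub>1 - \<Theta> \<epsilon> \<theta>\<^sub>2\<bar> \<le> C * (\<epsilon> powr \<delta> + \<epsilon> powr (- \<beta>') * \<bar>\<theta>\<^sub>1 - \<theta>\<^sub>2\<bar> powr \<beta>)"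
  shows "\<forall>\<gamma>::real. 0 < \<gamma> \<and> \<gamma> \<le> (1 + \<alpha> - 2 * \<beta>' / \<beta>) / (1 + 2 / \<beta>) \<and> \<gamma> < \<delta> \<longrightarrow>
    (\<lambda>\<epsilon>. SUP \<theta>\<in>{0..pi}. \<bar>\<Theta> \<epsilon> \<theta> - \<theta>\<bar>) \<in> O[at_right 0](\<lambda>\<epsilon>. \<epsilon> powr \<gamma>)"
proof (intro allI impI)
  fix \<gamma> :: real
  assume \<gamma>: "0 < \<gamma> \<and> \<gamma> \<le> (1 + \<alpha> - 2 * \<beta>' / \<beta>) / (1 + 2 / \<beta>) \<and> \<gamma> < \<delta>"
  have "\<gamma> * (\<beta> - 1) \<le> \<beta>'"
    using assms(1,2,4) \<gamma> by (intro hoelder_exponent_constraint[OF _ _ _ _ _ endpoints hoelder]) auto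
  then have exponent: "2 * \<gamma> \<le> 1 + \<alpha>"
    using assms(3,4) \<gamma> by (intro rate_exponent_le_half) auto
  have cont: "continuous_on {0..pi} (\<Theta> \<epsilon>)" if "\<epsilon> \<in> {0<..<\<epsilon>\<^sub>0}" for \<epsilon>
    using homeo[OF that] by (auto simp: homeomorphism_def)
  have range: "\<Theta> \<epsilon> x \<in> {0..pi}" if "\<epsilon> \<in> {0<..<\<epsilon>\<^sub>0}" "x \<in> {0..pi}" for \<epsilon> x
    using homeo[OF that(1)] that(2) by (auto simp: homeomorphism_def)
  have "\<exists>a. 0 < a \<and> a \<le> pi / 2 \<and> (\<forall>x\<in>{0..pi}. \<bar>\<Theta> \<epsilon> x - x\<bar> \<le> a - \<Theta> \<epsilon> a)"
    if "\<epsilon> \<in> {0<..<\<epsilon>\<^sub>0}" for \<epsilon>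
    by (rule maximal_displacement_attained_leftwards[OF cont[OF that] symmetric[OF that]
          superadditive[OF that] conjunct1[OF endpoints[OF that]]]) auto
  then obtain a where a: "\<And>\<epsilon>. \<epsilon> \<in> {0<..<\<epsilon>\<^sub>0} \<Longrightarrow> 0 < a \<epsilon> \<and> a \<epsilon> \<le> pi / 2 \<and>
      (\<forall>x\<in>{0..pi}. \<bar>\<Theta> \<epsilon> x - x\<bar> \<le> a \<epsilon> - \<Theta> \<epsilon> (a \<epsilon>))"
    by metis
  \<comment> \<open>Dividing by \<open>a\<^sup>2\<close> keeps the family bounded by \<open>\<epsilon>\<^sup>-\<^sup>\<alpha>\<close> even where \<open>a\<close> tends to \<open>0\<close> with \<open>\<epsilon>\<close>.\<close>
  define J where "J \<epsilon> x = \<epsilon> powr (- \<alpha>) / (a \<epsilon>)\<^sup>2 * cosine_cap (a \<epsilon>) x" for \<epsilon> x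
  have eps: "\<forall>\<^sub>F \<epsilon> in at_right 0. \<epsilon> \<in> {0<..<min \<epsilon>\<^sub>0 1}"
    using assms(1) by (intro eventually_at_right_real) auto
  have "\<exists>R :: real \<Rightarrow> real. R \<in> O[at_right 0](\<lambda>\<epsilon>. \<epsilon>) \<and>
      (\<forall>\<epsilon>\<in>{0<..<\<epsilon>\<^sub>0}. integral {0..pi} (\<lambda>\<theta>. J \<epsilon> (\<Theta> \<epsilon> \<theta>) * sin \<theta>)
        \<le> integral {0..pi} (\<lambda>\<theta>. J \<epsilon> \<theta> * sin \<theta>) + R \<epsilon>)"
  proof (rule convex_ineq)
    show "continuous_on {0..pi} (J \<epsilon>) \<and> convex_on {0..pi} (J \<epsilon>)" if "\<epsilon> \<in> {0<..<\<epsilon>\<^sub>0}" for \<epsilon>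
      unfolding J_def using a[OF that]
      by (intro conjI continuous_intros continuous_on_cosine_cap convex_on_cmul convex_on_cosine_cap) auto
    show "(\<lambda>\<epsilon>. SUP \<theta>\<in>{0..pi}. \<bar>J \<epsilon> \<theta>\<bar>) \<in> O[at_right 0](\<lambda>\<epsilon>. \<epsilon> powr (- \<alpha>))"
    proof (rule bigoI[where c = 1], rule eventually_mono[OF eps])
      fix \<epsilon> :: real assume "\<epsilon> \<in> {0<..<min \<epsilon>\<^sub>0 1}"
      then have \<epsilon>: "\<epsilon> \<in> {0<..<\<epsilon>\<^sub>0}" by simp
      have "\<bar>J \<epsilon> \<theta>\<bar> \<le> \<epsilon> powr (- \<alpha>)" if "\<theta> \<in> {0..pi}" for \<theta>
      proof -
        have "\<bar>J \<epsilon> \<theta>\<bar> = \<epsilon> powr (- \<alpha>) / (a \<epsilon>)\<^sup>2 * cosine_cap (a \<epsilon>) \<theta>"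
          using cosine_cap_bounds[of "a \<epsilon>" \<theta>] a[OF \<epsilon>] that by (simp add: J_def abs_mult)
        also have "\<dots> \<le> \<epsilon> powr (- \<alpha>) / (a \<epsilon>)\<^sup>2 * (a \<epsilon>)\<^sup>2"
          using cosine_cap_bounds[of "a \<epsilon>" \<theta>] a[OF \<epsilon>] that by (intro mult_left_mono) auto
        also have "\<dots> = \<epsilon> powr (- \<alpha>)" using a[OF \<epsilon>] by simp
        finally show ?thesis .
      qed
      then have "\<bar>SUP \<theta>\<in>{0..pi}. \<bar>J \<epsilon> \<theta>\<bar>\<bar> \<le> \<epsilon> powr (- \<alpha>)"
        by (intro cSup_abs_le) auto
      then show "norm (SUP \<theta>\<in>{0..pi}. \<bar>J \<epsilon> \<theta>\<bar>) \<le> 1 * norm (\<epsilon> powr (- \<alpha>))"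
        by simp
    qed
  qed
  then obtain R :: "real \<Rightarrow> real" where R: "R \<in> O[at_right 0](\<lambda>\<epsilon>. \<epsilon>)"
    and convex_R: "\<And>\<epsilon>. \<epsilon> \<in> {0<..<\<epsilon>\<^sub>0} \<Longrightarrow> integral {0..pi} (\<lambda>\<theta>. J \<epsilon> (\<Theta> \<epsilon> \<theta>) * sin \<theta>)
        \<le> integral {0..pi} (\<lambda>\<theta>. J \<epsilon> \<theta> * sin \<theta>) + R \<epsilon>"
    by blast
  have square_le: "(a \<epsilon> - \<Theta> \<epsilon> (a \<epsilon>))\<^sup>2 \<le> 3 * pi\<^sup>2 * (\<epsilon> powr \<alpha> * R \<epsilon>)"
    if \<epsilon>: "\<epsilon> \<in> {0<..<\<epsilon>\<^sub>0}" for \<epsilon>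
  proof -
    define b m where "b = a \<epsilon>" and "m = b - \<Theta> \<epsilon> b"
    have b: "0 < b" "b \<le> pi / 2" "b \<in> {0..pi}" using a[OF \<epsilon>] by (auto simp: b_def)
    have m: "0 \<le> m" "m \<le> b"
      using a[OF \<epsilon>] b(3) range[OF \<epsilon> b(3)] by (force simp: m_def b_def)+
    define I where "I = integral {0..pi} (\<lambda>\<theta>. cosine_cap b \<theta> * sin \<theta>)"
    define I' where "I' = integral {0..pi} (\<lambda>\<theta>. cosine_cap b (\<Theta> \<epsilon> \<theta>) * sin \<theta>)"
    have detect: "m * b ^ 3 / (3 * pi\<^sup>2) + I \<le> I'"
      unfolding I_def I'_def m_def
    proof (rule cosine_cap_detects_displacement[OF _ b(2) cont[OF \<epsilon>]])
      show "0 \<le> \<Theta> \<epsilon> x" if "x \<in> {0..pi}" for x using range[OF \<epsilon> that] by simp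
      show "\<Theta> \<epsilon> x + \<Theta> \<epsilon> y \<le> \<Theta> \<epsilon> b" if "0 \<le> x" "0 \<le> y" "x + y = b" for x y
        using superadditive[OF \<epsilon>, of x y] that b by auto
    qed (use b m in \<open>auto simp: m_def\<close>)
    have "\<epsilon> powr (- \<alpha>) / b\<^sup>2 * I' \<le> \<epsilon> powr (- \<alpha>) / b\<^sup>2 * I + R \<epsilon>"
      using convex_R[OF \<epsilon>]
      by (simp add: J_def I_def I'_def b_def mult.assoc del: times_divide_eq_left)
    then have "\<epsilon> powr (- \<alpha>) / b\<^sup>2 * (I' - I) \<le> R \<epsilon>" by (simp add: right_diff_distrib)
    moreover have "\<epsilon> powr (- \<alpha>) / b\<^sup>2 * (m * b ^ 3 / (3 * pi\<^sup>2)) \<le> \<epsilon> powr (- \<alpha>) / b\<^sup>2 * (I' - I)"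
      using detect by (intro mult_left_mono) auto
    ultimately have "\<epsilon> powr (- \<alpha>) / b\<^sup>2 * (m * b ^ 3 / (3 * pi\<^sup>2)) \<le> R \<epsilon>" by linarith
    then have "m * b \<le> 3 * pi\<^sup>2 * (\<epsilon> powr \<alpha> * R \<epsilon>)"
      using b \<epsilon> by (simp add: powr_minus field_simps power2_eq_square power3_eq_cube)
    \<comment> \<open>\<open>m \<le> b\<close> turns the bound on \<open>m * b\<close> into one that is uniform in the position \<open>b\<close>\<close>
    moreover have "m\<^sup>2 \<le> m * b" using m by (simp add: power2_eq_square mult_left_mono)
    ultimately show ?thesis by (simp add: m_def b_def)
  qed
  obtain K where K: "0 < K" "\<forall>\<^sub>F \<epsilon> in at_right 0. norm (R \<epsilon>) \<le> K * norm \<epsilon>"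
    using landau_o.bigE[OF R] by auto
  show "(\<lambda>\<epsilon>. SUP \<theta>\<in>{0..pi}. \<bar>\<Theta> \<epsilon> \<theta> - \<theta>\<bar>) \<in> O[at_right 0](\<lambda>\<epsilon>. \<epsilon> powr \<gamma>)"
  proof (rule bigoI[where c = "sqrt (3 * pi\<^sup>2 * K)"], rule eventually_mono[OF eventually_conj[OF eps K(2)]])
    fix \<epsilon> :: real
    assume *: "\<epsilon> \<in> {0<..<min \<epsilon>\<^sub>0 1} \<and> norm (R \<epsilon>) \<le> K * norm \<epsilon>"
    then have \<epsilon>: "\<epsilon> \<in> {0<..<\<epsilon>\<^sub>0}" "0 < \<epsilon>" "\<epsilon> < 1" and R_le: "R \<epsilon> \<le> K * \<epsilon>" by auto
    define m where "m = a \<epsilon> - \<Theta> \<epsilon> (a \<epsilon>)"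
    have "\<epsilon> powr \<alpha> * R \<epsilon> \<le> \<epsilon> powr \<alpha> * (K * \<epsilon>)"
      using R_le by (intro mult_left_mono) auto
    also have "\<dots> = K * \<epsilon> powr (1 + \<alpha>)" using \<epsilon> by (simp add: powr_add)
    also have "\<dots> \<le> K * \<epsilon> powr (2 * \<gamma>)"
      using K exponent \<epsilon> by (intro mult_left_mono powr_mono') auto
    also have "\<dots> = K * (\<epsilon> powr \<gamma>)\<^sup>2"
      using \<epsilon> by (simp add: powr_add[symmetric] power2_eq_square)
    finally have "3 * pi\<^sup>2 * (\<epsilon> powr \<alpha> * R \<epsilon>) \<le> 3 * pi\<^sup>2 * (K * (\<epsilon> powr \<gamma>)\<^sup>2)"
      by (intro mult_left_mono) auto
    then have "m\<^sup>2 \<le> 3 * pi\<^sup>2 * K * (\<epsilon> powr \<gamma>)\<^sup>2"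
      using square_le[OF \<epsilon>(1)] unfolding m_def mult.assoc by (rule order_trans[rotated])
    then have "sqrt (m\<^sup>2) \<le> sqrt (3 * pi\<^sup>2 * K * (\<epsilon> powr \<gamma>)\<^sup>2)" by (rule real_sqrt_le_mono)
    then have "m \<le> sqrt (3 * pi\<^sup>2 * K) * \<epsilon> powr \<gamma>"
      unfolding real_sqrt_mult[of _ "(\<epsilon> powr \<gamma>)\<^sup>2"] by (simp only: real_sqrt_abs) simp
    moreover have "\<bar>SUP \<theta>\<in>{0..pi}. \<bar>\<Theta> \<epsilon> \<theta> - \<theta>\<bar>\<bar> \<le> m"
      using a[OF \<epsilon>(1)] by (intro cSup_abs_le) (auto simp: m_def)
    ultimately show "norm (SUP \<theta>\<in>{0..pi}. \<bar>\<Theta> \<epsilon> \<theta> - \<theta>\<bar>) \<le> sqrt (3 * pi\<^sup>2 * K) * norm (\<epsilon> powr \<gamma>)"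
      by simp
  qed
qed

end
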